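(* Let $n\ge1$ and let $\mathcal{T}=\{(i_1,j_1),\ldots,(i_{n-1},j_{n-1})\}$ be the set of directed edges of a directed tree on the vertex set $\{1,\ldots,n\}$ (i.e. the underlying undirected graph is a tree, each edge carrying an arbitrary orientation). Then, in $\hat{\mathcal{P}}^n$ (as functions on $\mathbb{R}^n$), $$[\langle e_{i_1}-e_{j_1},\ldots,e_{i_{n-1}}-e_{j_{n-1}}\rangle_+]=\sum_{\pi}(-1)^{n-\operatorname{len}(\pi)}[\pi],$$ where $\pi$ ranges over all ordered set partitions of $\{1,\ldots,n\}$ such that, for every $a=1,\ldots,n-1$, the block containing $i_a$ lies strictly to the left of the block containing $j_a$.
   Context: $e_1,\ldots,e_n$ is the standard basis of $\mathbb{R}^n$, $V_0^n=\{x:\sum x_i=0\}$, $x_S=\sum_{i\in S}x_i$. $\langle v_1,\ldots,v_k\rangle_+=\{c_1v_1+\cdots+c_kv_k:c_i\ge0\}$ is the conical hull, and $[C]$ is the characteristic function of $C$. For an ordered set partition $\pi=(S_1,\ldots,S_k)$ of $\{1,\ldots,n\}$ (nonempty disjoint blocks with union $\{1,\ldots,n\}$), $\operatorname{len}(\pi)=k$ and $[\pi]$ is the characteristic function of the plate $\{x\in V_0^n:x_{S_1}\ge0,\ldots,x_{S_1\cup\cdots\cup S_{k-1}}\ge0\}$. $\hat{\mathcal{P}}^n$ is the complex span of such characteristic functions. *)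

theory Defs
  imports
    "HOL-Analysis.Analysis"
    "HOL-Library.Disjoint_Sets"
    "HOL-Library.Function_Algebras"
    "Graph_Theory.Graph_Theory"
begin

text \<open>
  The index set \<open>{1,\<dots>,n}\<close> is an arbitrary finite type \<open>'n\<close>, so that \<open>n = CARD('n) \<ge> 1\<close>,
  \<open>\<real>\<^sup>n\<close> is \<open>real ^ 'n\<close> and \<open>e\<^sub>i\<close> is \<open>axis i 1\<close>.
\<close>

definition V0 :: "(real ^ 'n) set" where
  "V0 = {x. (\<Sum>i\<in>UNIV. x $ i) = 0}"

definition coord_sum :: "real ^ 'n \<Rightarrow> 'n set \<Rightarrow> real" where
  "coord_sum x S = (\<Sum>i\<in>S. x $ i)"

text \<open>The hull of the empty family is \<open>{0}\<close>.\<close>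

definition conical_hull :: "'i set \<Rightarrow> ('i \<Rightarrow> 'v::real_vector) \<Rightarrow> 'v set" where
  "conical_hull I v = {\<Sum>a\<in>I. c a *\<^sub>R v a | c. \<forall>a\<in>I. 0 \<le> c a}"

definition ordered_set_partitions :: "'n::finite set list set" where
  "ordered_set_partitions = {\<pi>. distinct \<pi> \<and> partition_on UNIV (set \<pi>)}"

lemma finite_ordered_set_partitions: "finite ordered_set_partitions"
proof (rule finite_subset)
  show "ordered_set_partitions \<subseteq> {\<pi>. set \<pi> \<subseteq> UNIV \<and> distinct \<pi>}"
    by (auto simp: ordered_set_partitions_def)
  show "finite {\<pi> :: 'a set list. set \<pi> \<subseteq> UNIV \<and> distinct \<pi>}"
    by (rule finite_subset_distinct) simp
qed

text \<open>
  The inequality for the union of all blocks is not imposed; there the coordinate sum is zero.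
\<close>

definition plate :: "'n::finite set list \<Rightarrow> (real ^ 'n) set" where
  "plate \<pi> = {x \<in> V0. \<forall>m\<in>{1..<length \<pi>}. 0 \<le> coord_sum x (\<Union>(set (take m \<pi>)))}"

text \<open>The space \<open>\<P>\<close>-hat: the span over the complex numbers, inside all functions
  \<open>real ^ 'n \<Rightarrow> complex\<close> with pointwise operations.\<close>

definition fun_scale :: "complex \<Rightarrow> ('x \<Rightarrow> complex) \<Rightarrow> 'x \<Rightarrow> complex" where
  "fun_scale c f = (\<lambda>x. c * f x)"

interpretation fun_space: vector_space fun_scale
  by unfold_locales (auto simp: fun_scale_def fun_eq_iff algebra_simps)

definition plate_space :: "(real ^ 'n::finite \<Rightarrow> complex) set" where
  "plate_space = fun_space.span ((\<lambda>\<pi>. indicator (plate \<pi>)) ` ordered_set_partitions)"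

text \<open>
  A set \<open>T\<close> of arcs is an orientation of a simple graph iff it has neither loops nor pairs of
  antiparallel arcs, i.e. iff it is asymmetric. The underlying undirected graph is represented
  by the symmetric digraph \<open>mk_symmetric\<close>. In the latter every edge yields a closed walk of
  length two, so that the cycles of the undirected graph are those of length at least three.
  The constants \<open>forest\<close> and \<open>tree\<close> of the library cannot be used here: they only exclude
  directed cycles.
\<close>

definition directed_tree :: "('n \<times> 'n) set \<Rightarrow> bool" where
  "directed_tree T \<longleftrightarrow>
     (let G = with_proj \<lparr>pverts = UNIV, parcs = T\<rparr>
      in asym T \<and> Digraph_Component.connected G \<and>
         \<not> (\<exists>p. pre_digraph.cycle (with_proj (mk_symmetric G)) p \<and> 3 \<le> length p))"

definition strictly_left :: "'n set list \<Rightarrow> 'n \<Rightarrow> 'n \<Rightarrow> bool" where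
  "strictly_left \<pi> i j \<longleftrightarrow> (\<exists>p q. p < q \<and> q < length \<pi> \<and> i \<in> \<pi> ! p \<and> j \<in> \<pi> ! q)"

end

theory Submission
  imports Defs
begin

text \<open>
  For \<open>x\<close> of coordinate sum zero, call a set of vertices good if its coordinate sum is nonnegative.
  An ordered set partition compatible with \<open>T\<close> is a flag of predecessor-closed sets whose steps
  contain no arc, and \<open>x\<close> lies in its plate iff all members of the flag are good. In the lattice of
  predecessor-closed sets the signs are products of negated Moebius function values, so the right-hand
  side is a negated reduced Euler characteristic of the poset of bad sets. It is 1 if there are none.
  Otherwise joining with a minimiser \<open>M\<close> of the coordinate sum keeps bad sets bad by modularity, so
  the poset of bad sets is contractible and the sum vanishes. By separation from the finitely generated
  cone, \<open>x\<close> belongs to the cone iff every predecessor-closed set is good.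
\<close>

section \<open>Predecessor-closed sets, their sinks, and flags\<close>

definition predecessor_closed :: "('a \<times> 'a) set \<Rightarrow> 'a set \<Rightarrow> bool" where
  "predecessor_closed T A \<longleftrightarrow> (\<forall>(i, j)\<in>T. j \<in> A \<longrightarrow> i \<in> A)"

text \<open>For predecessor-closed \<open>A\<close>, the subsets of \<open>sinks T A\<close> are
  exactly the arc-free \<open>S \<subseteq> A\<close> whose removal leaves a predecessor-closed set.
  The nonempty ones are the candidates for the last block.\<close>

definition sinks :: "('a \<times> 'a) set \<Rightarrow> 'a set \<Rightarrow> 'a set" where
  "sinks T A = {p \<in> A. \<forall>j\<in>A. (p, j) \<notin> T}"

text \<open>Both ends count: \<open>m = 0\<close> and \<open>m = length \<pi>\<close> demand that
  \<open>{}\<close> and \<open>A\<close> be good. An arc with head in \<open>A\<close> must have its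
  tail in a block, so \<open>A\<close> is predecessor-closed as soon as it has a flag.\<close>

definition flags :: "('a \<times> 'a) set \<Rightarrow> ('a set \<Rightarrow> bool) \<Rightarrow> 'a set \<Rightarrow> 'a set list set" where
  "flags T good A =
     {\<pi>. distinct \<pi> \<and> partition_on A (set \<pi>) \<and>
         (\<forall>(i, j)\<in>T. j \<in> A \<longrightarrow> strictly_left \<pi> i j) \<and>
         (\<forall>m\<le>length \<pi>. good (\<Union>(set (take m \<pi>))))}"

text \<open>The exponent adds \<open>length \<pi>\<close> instead of subtracting it: the parity is
  the same and truncated subtraction is avoided.\<close>

definition signed_flags :: "('a \<times> 'a) set \<Rightarrow> ('a set \<Rightarrow> bool) \<Rightarrow> 'a set \<Rightarrow> 'b::comm_ring_1" where
  "signed_flags T good A = (\<Sum>\<pi>\<in>flags T good A. (-1) ^ (card A + length \<pi>))"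

lemma predecessor_closedD:
  "predecessor_closed T A \<Longrightarrow> (i, j) \<in> T \<Longrightarrow> j \<in> A \<Longrightarrow> i \<in> A"
  by (auto simp: predecessor_closed_def)

lemma predecessor_closed_Un:
  "predecessor_closed T A \<Longrightarrow> predecessor_closed T B \<Longrightarrow> predecessor_closed T (A \<union> B)"
  by (auto simp: predecessor_closed_def)

lemma predecessor_closed_Int:
  "predecessor_closed T A \<Longrightarrow> predecessor_closed T B \<Longrightarrow> predecessor_closed T (A \<inter> B)"
  by (auto simp: predecessor_closed_def)

lemma predecessor_closed_diff_sinks:
  "predecessor_closed T A \<Longrightarrow> S \<subseteq> sinks T A \<Longrightarrow> predecessor_closed T (A - S)"
  by (fastforce simp: predecessor_closed_def sinks_def)

lemma sinks_diff: "X \<subseteq> sinks T A \<Longrightarrow> X \<inter> B = {} \<Longrightarrow> X \<subseteq> sinks T (A - B)"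
  by (auto simp: sinks_def)

text \<open>A maximal point of \<open>A - M\<close> along the arcs works: an arc from it into
  \<open>A\<close> would have its head in \<open>M\<close> by maximality, hence its tail in
  \<open>M\<close> by closure.\<close>

lemma acyclic_imp_sink_outside:
  assumes "acyclic T" "finite A" "predecessor_closed T M" "\<not> A \<subseteq> M"
  shows "\<exists>p\<in>sinks T A. p \<notin> M"
proof -
  have "finite (T \<inter> A \<times> A)" using assms(2) by blast
  moreover have "acyclic (T \<inter> A \<times> A)"
    by (rule acyclic_subset[OF assms(1)]) blast
  ultimately have "wf ((T \<inter> A \<times> A)\<inverse>)"
    by (rule finite_acyclic_wf_converse)
  moreover obtain a where "a \<in> A - M" using assms(4) by blast
  ultimately obtain p where p: "p \<in> A - M" "\<And>q. (q, p) \<in> (T \<inter> A \<times> A)\<inverse> \<Longrightarrow> q \<notin> A - M"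
    by (rule wfE_min) blast
  have "p \<in> sinks T A"
    using p predecessor_closedD[OF assms(3)] by (auto simp: sinks_def)
  with p show ?thesis by blast
qed

lemma strictly_left_snoc:
  "strictly_left (\<pi> @ [S]) i j \<longleftrightarrow> strictly_left \<pi> i j \<or> i \<in> \<Union>(set \<pi>) \<and> j \<in> S"
proof
  assume "strictly_left (\<pi> @ [S]) i j"
  then obtain p q where pq: "p < q" "q < Suc (length \<pi>)" "i \<in> (\<pi> @ [S]) ! p" "j \<in> (\<pi> @ [S]) ! q"
    by (auto simp: strictly_left_def)
  show "strictly_left \<pi> i j \<or> i \<in> \<Union>(set \<pi>) \<and> j \<in> S"
  proof (cases "q = length \<pi>")
    case True
    then show ?thesis using pq by (auto simp: nth_append intro: nth_mem)
  next
    case False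
    then show ?thesis using pq by (auto simp: nth_append strictly_left_def)
  qed
next
  assume "strictly_left \<pi> i j \<or> i \<in> \<Union>(set \<pi>) \<and> j \<in> S"
  then show "strictly_left (\<pi> @ [S]) i j"
  proof
    assume "strictly_left \<pi> i j"
    then obtain p q where "p < q" "q < length \<pi>" "i \<in> \<pi> ! p" "j \<in> \<pi> ! q"
      by (auto simp: strictly_left_def)
    then show ?thesis
      unfolding strictly_left_def by (intro exI[of _ p] exI[of _ q]) (auto simp: nth_append)
  next
    assume ij: "i \<in> \<Union>(set \<pi>) \<and> j \<in> S"
    then obtain p where "p < length \<pi>" "i \<in> \<pi> ! p"
      by (auto simp: in_set_conv_nth)
    with ij show ?thesis
      unfolding strictly_left_def by (intro exI[of _ p] exI[of _ "length \<pi>"]) (auto simp: nth_append)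
  qed
qed

lemma strictly_left_imp_mem:
  "strictly_left \<pi> i j \<Longrightarrow> i \<in> \<Union>(set \<pi>) \<and> j \<in> \<Union>(set \<pi>)"
  unfolding strictly_left_def by (metis UnionI less_trans nth_mem)

lemma flags_imp_predecessor_closed: "\<pi> \<in> flags T good A \<Longrightarrow> predecessor_closed T A"
  by (fastforce simp: flags_def predecessor_closed_def partition_on_def dest: strictly_left_imp_mem)

lemma flags_imp_good: "\<pi> \<in> flags T good A \<Longrightarrow> good A"
  by (auto simp: flags_def partition_on_def dest: spec[where x = "length \<pi>"])

text \<open>All other blocks lie to the left of \<open>S\<close>, so no arc runs from
  \<open>S\<close> to a point of \<open>A\<close>. Conversely, an arc into \<open>S\<close> has its
  tail in \<open>A\<close> by closure and outside \<open>S\<close> because \<open>S\<close> consists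
  of sinks, thus in an earlier block.\<close>

lemma snoc_mem_flags_iff:
  assumes "predecessor_closed T A"
  shows "\<pi> @ [S] \<in> flags T good A \<longleftrightarrow>
    good A \<and> S \<noteq> {} \<and> S \<subseteq> sinks T A \<and> \<pi> \<in> flags T good (A - S)"
proof
  assume L: "\<pi> @ [S] \<in> flags T good A"
  then have dist: "distinct \<pi>" "S \<notin> set \<pi>" and part: "partition_on A (insert S (set \<pi>))"
    and left: "\<And>i j. (i, j) \<in> T \<Longrightarrow> j \<in> A \<Longrightarrow> strictly_left \<pi> i j \<or> i \<in> \<Union>(set \<pi>) \<and> j \<in> S"
    and good: "\<And>m. m \<le> Suc (length \<pi>) \<Longrightarrow> good (\<Union>(set (take m (\<pi> @ [S]))))"
    by (auto simp: flags_def strictly_left_snoc)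
  have disj: "disjnt S (\<Union>(set \<pi>))"
    using part dist by (auto simp: partition_on_def disjoint_def disjnt_def)
  have part': "partition_on (A - S) (set \<pi>)" "S \<subseteq> A" "S \<noteq> {}"
    using part partition_on_insert[OF disj] by auto
  have un: "\<Union>(set \<pi>) = A - S" using part' by (simp add: partition_on_def)
  have "S \<subseteq> sinks T A"
    using part' left un unfolding sinks_def by (blast dest: strictly_left_imp_mem)
  moreover have "good (\<Union>(set (take m \<pi>)))" if "m \<le> length \<pi>" for m
    using good[of m] that by simp
  moreover have "strictly_left \<pi> i j" if "(i, j) \<in> T" "j \<in> A - S" for i j
    using left that by blast
  ultimately show "good A \<and> S \<noteq> {} \<and> S \<subseteq> sinks T A \<and> \<pi> \<in> flags T good (A - S)"
    using flags_imp_good[of _ T good A, OF L] part' dist by (auto simp: flags_def)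
next
  assume R: "good A \<and> S \<noteq> {} \<and> S \<subseteq> sinks T A \<and> \<pi> \<in> flags T good (A - S)"
  then have dist: "distinct \<pi>" and part: "partition_on (A - S) (set \<pi>)"
    and left: "\<And>i j. (i, j) \<in> T \<Longrightarrow> j \<in> A - S \<Longrightarrow> strictly_left \<pi> i j"
    and good: "\<And>m. m \<le> length \<pi> \<Longrightarrow> good (\<Union>(set (take m \<pi>)))"
    by (auto simp: flags_def)
  have un: "\<Union>(set \<pi>) = A - S" using part by (simp add: partition_on_def)
  have "S \<subseteq> A" using R by (auto simp: sinks_def)
  have "partition_on A (insert S (set \<pi>))"
    using partition_on_insert[of S "set \<pi>" A] un part R \<open>S \<subseteq> A\<close> by (auto simp: disjnt_def)
  moreover have "S \<notin> set \<pi>" using un R by blast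
  moreover have "strictly_left (\<pi> @ [S]) i j" if "(i, j) \<in> T" "j \<in> A" for i j
  proof (cases "j \<in> S")
    case True
    then have "i \<in> A - S"
      using R that predecessor_closedD[OF assms] by (auto simp: sinks_def)
    then show ?thesis using True un by (simp add: strictly_left_snoc)
  next
    case False
    then show ?thesis using left that by (simp add: strictly_left_snoc)
  qed
  moreover have "good (\<Union>(set (take m (\<pi> @ [S]))))" if "m \<le> Suc (length \<pi>)" for m
  proof (cases "m \<le> length \<pi>")
    case True
    then show ?thesis using good by simp
  next
    case False
    then have "take m (\<pi> @ [S]) = \<pi> @ [S]" by simp
    moreover have "\<Union>(set (\<pi> @ [S])) = A" using un \<open>S \<subseteq> A\<close> by auto
    ultimately show ?thesis using R by metis
  qed
  ultimately show "\<pi> @ [S] \<in> flags T good A"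
    using dist by (auto simp: flags_def)
qed

section \<open>Recursion for the signed flag count\<close>

lemma finite_flags: "finite A \<Longrightarrow> finite (flags T good A)"
  by (rule finite_subset[OF _ finite_subset_distinct[of "Pow A"]])
     (auto simp: flags_def partition_on_def)

lemma signed_flags_empty: "good {} \<Longrightarrow> signed_flags T good {} = 1"
proof -
  assume "good {}"
  then have "flags T good {} = {[]}"
    by (auto simp: flags_def partition_on_empty)
  then show ?thesis by (simp add: signed_flags_def)
qed

lemma signed_flags_bad: "\<not> good A \<Longrightarrow> signed_flags T good A = 0"
  using flags_imp_good[of _ T good A] by (auto simp: signed_flags_def intro!: sum.neutral)

text \<open>Splitting the flags of \<open>A\<close> by their last block \<open>S\<close> expresses
  \<open>signed_flags T good A\<close> through the sets \<open>A - S\<close> with \<open>S\<close>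
  nonempty; brought to the other side, it becomes the term for \<open>S = {}\<close>.\<close>

lemma signed_flags_sinks:
  assumes fin: "finite A" and A: "predecessor_closed T A" "A \<noteq> {}" "good A"
  shows "(\<Sum>S\<in>Pow (sinks T A). (-1) ^ card S * signed_flags T good (A - S)) = (0 :: 'b::comm_ring_1)"
proof -
  define P where "P = Pow (sinks T A) - {{}}"
  have finP: "finite P" "finite (sinks T A)"
    using fin by (auto simp: P_def sinks_def)
  have sub: "S \<subseteq> A" "finite S" if "S \<in> P" for S
    using that fin by (auto simp: P_def sinks_def intro: finite_subset)
  have eq: "flags T good A = (\<lambda>(S, \<pi>). \<pi> @ [S]) ` (SIGMA S:P. flags T good (A - S))"
  proof (intro equalityI subsetI)
    fix \<pi> assume \<pi>: "\<pi> \<in> flags T good A"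
    then have "\<pi> \<noteq> []" using A by (auto simp: flags_def partition_on_def)
    then obtain \<rho> S where "\<pi> = \<rho> @ [S]" by (metis rev_exhaust)
    with \<pi> show "\<pi> \<in> (\<lambda>(S, \<pi>). \<pi> @ [S]) ` (SIGMA S:P. flags T good (A - S))"
      using snoc_mem_flags_iff[OF A(1)] by (force simp: P_def)
  next
    fix \<pi> assume "\<pi> \<in> (\<lambda>(S, \<pi>). \<pi> @ [S]) ` (SIGMA S:P. flags T good (A - S))"
    then show "\<pi> \<in> flags T good A"
      using snoc_mem_flags_iff[OF A(1)] A(3) by (auto simp: P_def)
  qed
  have inj: "inj_on (\<lambda>(S, \<pi>). \<pi> @ [S]) (SIGMA S:P. flags T good (A - S))"
    by (auto simp: inj_on_def)
  \<comment> \<open>The \<open>Suc\<close> counts the appended block \<open>S\<close> and yields the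
    minus sign below.\<close>
  have "signed_flags T good A =
      (\<Sum>(S, \<pi>)\<in>(SIGMA S:P. flags T good (A - S)). (-1) ^ (card A + Suc (length \<pi>)) :: 'b)"
    unfolding signed_flags_def eq sum.reindex[OF inj] by (rule sum.cong) auto
  also have "\<dots> = (\<Sum>S\<in>P. \<Sum>\<pi>\<in>flags T good (A - S). (-1) ^ (card A + Suc (length \<pi>)))"
    using finP fin by (subst sum.Sigma) (auto simp: finite_flags)
  also have "\<dots> = (\<Sum>S\<in>P. - ((-1) ^ card S * signed_flags T good (A - S)))"
  proof (rule sum.cong[OF refl])
    fix S assume S: "S \<in> P"
    have "card A = card S + card (A - S)"
      using card_Diff_subset[OF sub(2)[OF S] sub(1)[OF S]] card_mono[OF fin sub(1)[OF S]] by simp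
    then show "(\<Sum>\<pi>\<in>flags T good (A - S). (-1) ^ (card A + Suc (length \<pi>))) =
        - ((-1) ^ card S * signed_flags T good (A - S) :: 'b)"
      by (simp add: signed_flags_def sum_distrib_left sum_negf power_add algebra_simps)
  qed
  finally have "signed_flags T good A =
      (- (\<Sum>S\<in>P. (-1) ^ card S * signed_flags T good (A - S)) :: 'b)"
    by (simp add: sum_negf)
  moreover have "(\<Sum>S\<in>Pow (sinks T A). (-1) ^ card S * signed_flags T good (A - S)) =
      signed_flags T good A + (\<Sum>S\<in>P. (-1) ^ card S * signed_flags T good (A - S) :: 'b)"
    using finP by (subst sum.remove[of _ "{}"]) (auto simp: P_def)
  ultimately show ?thesis by simp
qed

lemma inj_on_insert_Pow: "p \<notin> X \<Longrightarrow> inj_on (insert p) (Pow X)"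
  by (rule inj_onI) (metis PowD insert_ident subsetD)

text \<open>
  Think of the interval of predecessor-closed sets between \<open>X\<close> and \<open>A\<close>. A sink \<open>p\<close> of \<open>A\<close> outside
  \<open>X\<close> splits it into the sets that contain \<open>p\<close> and those that do not, which are again intervals of
  this kind; when no such \<open>p\<close> is left, the claim is the recursion for \<open>signed_flags\<close>.
\<close>

lemma signed_flags_interval:
  assumes "finite A" "predecessor_closed T A" "X \<noteq> {}" "X \<subseteq> sinks T A"
    and "\<And>B. predecessor_closed T B \<Longrightarrow> X \<subseteq> B \<Longrightarrow> B \<subseteq> A \<Longrightarrow> good B"
  shows "(\<Sum>S\<in>Pow X. (-1) ^ card S * signed_flags T good (A - S)) = (0 :: 'b::comm_ring_1)"
  using assms
proof (induction "card A + card (A - X)" arbitrary: A X rule: less_induct)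
  case less
  have XA: "X \<subseteq> A" using less.prems(4) by (auto simp: sinks_def)
  then have fin: "finite X" using less.prems(1) by (rule finite_subset)
  show ?case
  proof (cases "X = sinks T A")
    case True
    \<comment> \<open>\<open>A\<close> is nonempty because it contains \<open>X\<close>, and good by
      the last hypothesis with \<open>B = A\<close>.\<close>
    then show ?thesis
      using less.prems XA by (auto intro!: signed_flags_sinks)
  next
    case False
    then obtain p where p: "p \<in> sinks T A" "p \<notin> X" using less.prems(4) by blast
    then have pA: "p \<in> A" by (auto simp: sinks_def)
    \<comment> \<open>The measure drops in both cases: adding \<open>p\<close> to \<open>X\<close>
      keeps \<open>A\<close> and shrinks \<open>A - X\<close>, while deleting \<open>p\<close> from
      \<open>A\<close> shrinks \<open>A\<close> and does not enlarge \<open>A - X\<close>.\<close>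
    have "card (A - insert p X) < card (A - X)"
      using p pA less.prems(1) by (intro psubset_card_mono) auto
    then have with_p: "(\<Sum>S\<in>Pow (insert p X). (-1) ^ card S * signed_flags T good (A - S)) = (0 :: 'b)"
      using less.prems p by (intro less.hyps) auto
    have "card (A - {p}) < card A" "card (A - {p} - X) \<le> card (A - X)"
      using pA less.prems(1) card_Diff1_less[of A p] by (blast, intro card_mono) auto
    then have without_p: "(\<Sum>S\<in>Pow X. (-1) ^ card S * signed_flags T good (A - {p} - S)) = (0 :: 'b)"
      using less.prems p
      by (intro less.hyps predecessor_closed_diff_sinks sinks_diff) auto
    have inj: "inj_on (insert p) (Pow X)"
      using p by (intro inj_on_insert_Pow) auto
    \<comment> \<open>Subsets containing \<open>p\<close> carry the opposite sign, so the sum in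
      \<open>with_p\<close> is the wanted sum minus the one in \<open>without_p\<close>.\<close>
    have "(\<Sum>S\<in>Pow (insert p X). (-1) ^ card S * signed_flags T good (A - S)) =
        (\<Sum>S\<in>Pow X. (-1) ^ card S * signed_flags T good (A - S)) +
        (\<Sum>S\<in>insert p ` Pow X. (-1) ^ card S * signed_flags T good (A - S) :: 'b)"
      unfolding Pow_insert using p fin by (intro sum.union_disjoint) auto
    also have "(\<Sum>S\<in>insert p ` Pow X. (-1) ^ card S * signed_flags T good (A - S)) =
        (\<Sum>S\<in>Pow X. - ((-1) ^ card S * signed_flags T good (A - {p} - S)) :: 'b)"
    proof (unfold sum.reindex[OF inj], rule sum.cong[OF refl])
      fix S assume "S \<in> Pow X"
      then have "card (insert p S) = Suc (card S)" "A - insert p S = A - {p} - S"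
        using p fin by (auto simp: card_insert_if finite_subset)
      then show "((\<lambda>S. (-1) ^ card S * signed_flags T good (A - S)) \<circ> insert p) S =
          - ((-1) ^ card S * signed_flags T good (A - {p} - S) :: 'b)"
        by simp
    qed
    finally show ?thesis
      using with_p without_p by (simp add: sum_negf)
  qed
qed

section \<open>Values of the signed flag count\<close>

lemma sum_Pow_remove_empty:
  fixes g :: "'a set \<Rightarrow> 'b::comm_ring_1"
  assumes "finite X" "(\<Sum>S\<in>Pow X. (-1) ^ card S * g S) = 0"
  shows "g {} = - (\<Sum>S\<in>Pow X - {{}}. (-1) ^ card S * g S)"
  using assms sum.remove[of "Pow X" "{}" "\<lambda>S. (-1) ^ card S * g S"]
  by (simp add: eq_neg_iff_add_eq_0)

lemma sum_Pow_alternating: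
  assumes "finite X" "X \<noteq> {}"
  shows "(\<Sum>S\<in>Pow X. (-1) ^ card S) = (0 :: 'b::comm_ring_1)"
  using assms
proof (induction X rule: finite_ne_induct)
  case (singleton x)
  then show ?case by (simp add: Pow_insert)
next
  case (insert x F)
  have "card (insert x S) = Suc (card S)" if "S \<in> Pow F" for S
    using that insert.hyps by (intro card_insert_disjoint) (auto intro: finite_subset)
  then have "(\<Sum>S\<in>insert x ` Pow F. (-1) ^ card S :: 'b) = (\<Sum>S\<in>Pow F. - ((-1) ^ card S))"
    using insert.hyps by (subst sum.reindex) (auto intro!: sum.cong inj_on_insert_Pow)
  then show ?case
    unfolding Pow_insert using insert
    by (subst sum.union_disjoint) (auto simp: sum_negf)
qed

text \<open>By induction all terms of the recursion with nonempty \<open>S\<close> have flag count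
  1. Acyclicity makes the set of sinks nonempty, so the alternating sum over its subsets vanishes,
  which forces the value 1 at \<open>S = {}\<close> as well.\<close>

lemma signed_flags_all_good:
  assumes "acyclic T" "finite A" "predecessor_closed T A"
    and "\<And>B. predecessor_closed T B \<Longrightarrow> B \<subseteq> A \<Longrightarrow> good B"
  shows "signed_flags T good A = (1 :: 'b::comm_ring_1)"
  using assms(2-)
proof (induction A rule: finite_psubset_induct)
  case (psubset A)
  have sinksA: "finite (sinks T A)" "sinks T A \<subseteq> A"
    using psubset.hyps by (auto simp: sinks_def)
  show ?case
  proof (cases "A = {}")
    case True
    then show ?thesis
      using psubset.prems by (simp add: signed_flags_empty)
  next
    case False
    then have ne: "sinks T A \<noteq> {}"
      using acyclic_imp_sink_outside[OF assms(1) psubset.hyps, of "{}"]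
      by (auto simp: predecessor_closed_def)
    have IH: "signed_flags T good (A - S) = (1 :: 'b)" if "S \<in> Pow (sinks T A) - {{}}" for S
      using that sinksA psubset.prems
      by (intro psubset.IH) (auto intro!: predecessor_closed_diff_sinks)
    have "signed_flags T good (A - {}) =
        (- (\<Sum>S\<in>Pow (sinks T A) - {{}}. (-1) ^ card S * signed_flags T good (A - S)) :: 'b)"
      using psubset.prems psubset.hyps False sinksA
      by (intro sum_Pow_remove_empty signed_flags_sinks) auto
    also have "\<dots> = - (\<Sum>S\<in>Pow (sinks T A) - {{}}. (-1) ^ card S * 1)"
      using IH by (intro arg_cong[where f = uminus] sum.cong) auto
    \<comment> \<open>\<open>sum_Pow_remove_empty\<close> is read from right to left here, for the
      constant function 1.\<close>
    also have "\<dots> = 1"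
      using sinksA ne by (intro sum_Pow_remove_empty[symmetric]) (auto simp: sum_Pow_alternating)
    finally show ?thesis by simp
  qed
qed

text \<open>If \<open>A\<close> is good, the interval lemma applies with \<open>X\<close> the sinks
  outside \<open>M\<close>. Removing a subset of \<open>X\<close> keeps \<open>M\<close>, so the
  terms with nonempty \<open>S\<close> vanish by induction and only \<open>S = {}\<close> remains.
  The bottom case \<open>A = M\<close> is bad and has no flags.\<close>

lemma signed_flags_above_minimiser:
  fixes w :: "'a \<Rightarrow> real"
  assumes acyc: "acyclic T"
    and M: "predecessor_closed T M" "sum w M < 0"
      "\<And>B. finite B \<Longrightarrow> predecessor_closed T B \<Longrightarrow> sum w M \<le> sum w B"
    and A: "finite A" "predecessor_closed T A" "M \<subseteq> A"
  shows "signed_flags T (\<lambda>B. 0 \<le> sum w B) A = (0 :: 'b::comm_ring_1)"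
  using A
proof (induction A rule: finite_psubset_induct)
  case (psubset A)
  define good where "good B \<longleftrightarrow> 0 \<le> sum w B" for B
  define X where "X = sinks T A - M"
  have X: "finite X" "X \<subseteq> sinks T A" "X \<subseteq> A" "X \<inter> M = {}"
    using psubset.hyps by (auto simp: X_def sinks_def)
  show ?case
  proof (cases "good A")
    case False
    then show ?thesis by (simp add: signed_flags_bad good_def)
  next
    case True
    then have "\<not> A \<subseteq> M"
      using M(2) psubset.prems by (auto simp: good_def)
    then have "X \<noteq> {}"
      using acyclic_imp_sink_outside[OF acyc psubset.hyps M(1)] by (auto simp: X_def)
    have "good B" if B: "predecessor_closed T B" "X \<subseteq> B" "B \<subseteq> A" for B
    proof -
      have "finite B" "finite M"
        using B psubset.hyps psubset.prems by (auto intro: finite_subset)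
      \<comment> \<open>A sink of \<open>A\<close> outside \<open>B \<union> M\<close> would lie in
        \<open>X\<close>, hence in \<open>B\<close>.\<close>
      have "A \<subseteq> B \<union> M"
        using acyclic_imp_sink_outside[OF acyc psubset.hyps predecessor_closed_Un[OF B(1) M(1)]] B(2)
        by (auto simp: X_def)
      then have "B \<union> M = A" using B psubset.prems by blast
      \<comment> \<open>Modularity and the minimality of \<open>M\<close> together give
        \<open>sum w A \<le> sum w B\<close>.\<close>
      then have "sum w A = sum w B + sum w M - sum w (B \<inter> M)"
        using sum_Un[OF \<open>finite B\<close> \<open>finite M\<close>, of w] by simp
      moreover have "sum w M \<le> sum w (B \<inter> M)"
        using \<open>finite B\<close> B M by (intro M(3) predecessor_closed_Int) auto
      ultimately show ?thesis using True by (simp add: good_def)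
    qed
    then have "(\<Sum>S\<in>Pow X. (-1) ^ card S * signed_flags T good (A - S)) = (0 :: 'b)"
      using psubset.hyps psubset.prems X \<open>X \<noteq> {}\<close> by (intro signed_flags_interval) auto
    then have "signed_flags T good (A - {}) =
        (- (\<Sum>S\<in>Pow X - {{}}. (-1) ^ card S * signed_flags T good (A - S)) :: 'b)"
      using X by (intro sum_Pow_remove_empty)
    also have "(\<Sum>S\<in>Pow X - {{}}. (-1) ^ card S * signed_flags T good (A - S) :: 'b) = 0"
    proof (intro sum.neutral ballI)
      fix S assume S: "S \<in> Pow X - {{}}"
      have "signed_flags T (\<lambda>B. 0 \<le> sum w B) (A - S) = (0 :: 'b)"
        using S X psubset.prems
        by (intro psubset.IH) (auto intro!: predecessor_closed_diff_sinks)
      then show "(-1) ^ card S * signed_flags T good (A - S) = (0 :: 'b)"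
        by (simp add: good_def[abs_def])
    qed
    finally show ?thesis by (simp add: good_def[abs_def])
  qed
qed

text \<open>If some predecessor-closed set is bad, a minimiser over these finitely many sets has
  negative sum and lies below \<open>UNIV\<close>, so the preceding lemma applies.\<close>

theorem signed_flags_UNIV:
  fixes T :: "('a::finite \<times> 'a) set" and w :: "'a \<Rightarrow> real"
  assumes "acyclic T"
  shows "signed_flags T (\<lambda>B. 0 \<le> sum w B) UNIV =
    (if \<forall>B. predecessor_closed T B \<longrightarrow> 0 \<le> sum w B then 1 else 0 :: 'b::comm_ring_1)"
proof (cases "\<forall>B. predecessor_closed T B \<longrightarrow> 0 \<le> sum w B")
  case True
  then show ?thesis
    using signed_flags_all_good[OF assms, of UNIV "\<lambda>B. 0 \<le> sum w B"]
    by (simp add: predecessor_closed_def)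
next
  case False
  have "{B. predecessor_closed T B} \<noteq> {}" using False by auto
  then obtain M where M: "predecessor_closed T M"
      "\<And>B. predecessor_closed T B \<Longrightarrow> sum w M \<le> sum w B"
    using ex_min_if_finite[of "sum w ` {B. predecessor_closed T B}"]
    by (auto simp: not_less)
  then have "sum w M < 0" using False by (meson less_le_trans not_le order_le_less_trans)
  then have "signed_flags T (\<lambda>B. 0 \<le> sum w B) UNIV = (0 :: 'b)"
    using M by (intro signed_flags_above_minimiser[OF assms, of M])
      (auto simp: predecessor_closed_def)
  then show ?thesis using False by simp
qed

section \<open>The cone of the arcs, by separation\<close>

text \<open>Abel summation over the levels of \<open>y\<close>: the lowest level is split off, and
  the part above it is handled by induction with the minimum \<open>m\<close> as the new lower
  bound.\<close>

lemma sum_mult_ge_if_upper_sums_nonneg: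
  fixes y w :: "'a \<Rightarrow> real"
  assumes "finite A"
    and "\<And>B. B \<subseteq> A \<Longrightarrow> (\<And>i j. i \<in> B \<Longrightarrow> j \<in> A \<Longrightarrow> y i \<le> y j \<Longrightarrow> j \<in> B) \<Longrightarrow> 0 \<le> sum w B"
    and "\<And>i. i \<in> A \<Longrightarrow> c \<le> y i"
  shows "c * sum w A \<le> (\<Sum>i\<in>A. y i * w i)"
  using assms
proof (induction A arbitrary: c rule: finite_psubset_induct)
  case (psubset A)
  show ?case
  proof (cases "A = {}")
    case False
    define m where "m = Min (y ` A)"
    define B where "B = {i \<in> A. m < y i}"
    have m: "m \<in> y ` A" "\<And>i. i \<in> A \<Longrightarrow> m \<le> y i"
      using psubset.hyps False by (auto simp: m_def)
    then have "B \<subset> A" by (auto simp: B_def)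
    have "c \<le> m" using m psubset.prems(2) by auto
    \<comment> \<open>\<open>A\<close> is an upper set of itself; this sign allows \<open>m\<close>
      to be lowered to \<open>c\<close> at the end.\<close>
    have "0 \<le> sum w A" by (rule psubset.prems(1)) auto
    have "m * sum w B \<le> (\<Sum>i\<in>B. y i * w i)"
    proof (rule psubset.IH[OF \<open>B \<subset> A\<close>])
      fix D assume "D \<subseteq> B" and D: "\<And>i j. i \<in> D \<Longrightarrow> j \<in> B \<Longrightarrow> y i \<le> y j \<Longrightarrow> j \<in> D"
      show "0 \<le> sum w D"
      proof (rule psubset.prems(1))
        show "D \<subseteq> A" using \<open>D \<subseteq> B\<close> \<open>B \<subset> A\<close> by blast
        fix i j assume "i \<in> D" "j \<in> A" "y i \<le> y j"
        \<comment> \<open>The bound \<open>m < y i\<close> passes to \<open>y j\<close>, so upper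
          sets of \<open>B\<close> are upper sets of \<open>A\<close>.\<close>
        moreover from this have "j \<in> B" using \<open>D \<subseteq> B\<close> by (auto simp: B_def)
        ultimately show "j \<in> D" using D by blast
      qed
    qed (simp add: B_def)
    moreover have "(\<Sum>i\<in>A - B. y i * w i) = m * sum w (A - B)"
      unfolding sum_distrib_left using m by (intro sum.cong) (force simp: B_def)+
    ultimately have "m * sum w A \<le> (\<Sum>i\<in>A. y i * w i)"
      using psubset.hyps \<open>B \<subset> A\<close>
      by (simp add: sum.subset_diff[of B A] algebra_simps psubset_imp_subset)
    moreover have "c * sum w A \<le> m * sum w A"
      using \<open>c \<le> m\<close> \<open>0 \<le> sum w A\<close> by (rule mult_right_mono)
    ultimately show ?thesis by simp
  qed simp
qed

lemma inner_arc: "y \<bullet> (axis i 1 - axis j 1 :: real ^ 'n::finite) = y $ i - y $ j"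
  by (simp add: inner_diff_right inner_axis)

lemma coord_sum_arc:
  "coord_sum (axis i 1 - axis j 1) A = indicator A i - (indicator A j :: real)"
  for i j :: "'n::finite"
  by (simp add: coord_sum_def axis_def sum_subtractf indicator_def)

lemma coord_sum_cone:
  "coord_sum (\<Sum>a\<in>T. c a *\<^sub>R v a) A = (\<Sum>a\<in>T. c a * coord_sum (v a) A)"
  for v :: "'i \<Rightarrow> real ^ 'n::finite"
  unfolding coord_sum_def by (simp add: sum_distrib_left) (rule sum.swap)

lemma convex_cone_conical_hull: "convex_cone (conical_hull I v)"
  unfolding convex_cone_iff
proof (intro conjI ballI allI impI)
  show "0 \<in> conical_hull I v"
    unfolding conical_hull_def by (auto intro!: exI[of _ "\<lambda>_. 0"])
  fix x assume "x \<in> conical_hull I v"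
  then obtain c where c: "x = (\<Sum>a\<in>I. c a *\<^sub>R v a)" "\<forall>a\<in>I. 0 \<le> c a"
    by (auto simp: conical_hull_def)
  {
    fix y assume "y \<in> conical_hull I v"
    then obtain d where d: "y = (\<Sum>a\<in>I. d a *\<^sub>R v a)" "\<forall>a\<in>I. 0 \<le> d a"
      by (auto simp: conical_hull_def)
    show "x + y \<in> conical_hull I v"
      using c d unfolding conical_hull_def
      by (auto intro!: exI[of _ "\<lambda>a. c a + d a"] simp: scaleR_left_distrib sum.distrib)
  }
  fix t :: real assume "0 \<le> t"
  then show "t *\<^sub>R x \<in> conical_hull I v"
    using c unfolding conical_hull_def
    by (auto intro!: exI[of _ "\<lambda>a. t * c a"] simp: scaleR_right.sum)
qed

text \<open>Makes separation available: a point outside \<open>conical_hull I v\<close> is outside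
  the convex cone hull of a finite set, which is closed.\<close>

lemma convex_cone_hull_image_subset_conical_hull:
  assumes "finite I"
  shows "convex_cone hull (v ` I) \<subseteq> conical_hull I v"
proof (rule hull_minimal)
  show "v ` I \<subseteq> conical_hull I v"
  proof
    fix x assume "x \<in> v ` I"
    then obtain a where "a \<in> I" "x = v a" by blast
    then show "x \<in> conical_hull I v"
      using assms unfolding conical_hull_def
      by (auto intro!: exI[of _ "\<lambda>b. if b = a then 1 else 0"] simp: if_distrib[of "\<lambda>r. r *\<^sub>R _"] cong: if_cong)
  qed
qed (rule convex_cone_conical_hull)

text \<open>A predecessor-closed set containing the head of an arc contains its tail, so every
  generator has nonnegative coordinate sum on it. Conversely, a separating \<open>y\<close> is
  weakly decreasing along arcs, its upper sets are predecessor-closed, and Abel summation forces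
  \<open>0 \<le> y \<bullet> x\<close>.\<close>

theorem mem_arc_cone_iff:
  fixes T :: "('n::finite \<times> 'n) set" and x :: "real ^ 'n"
  shows "x \<in> conical_hull T (\<lambda>(i, j). axis i 1 - axis j 1) \<longleftrightarrow>
    x \<in> V0 \<and> (\<forall>A. predecessor_closed T A \<longrightarrow> 0 \<le> coord_sum x A)"
    (is "x \<in> conical_hull T ?v \<longleftrightarrow> ?R")
proof
  assume "x \<in> conical_hull T ?v"
  then obtain c where x: "x = (\<Sum>a\<in>T. c a *\<^sub>R ?v a)" and c: "\<forall>a\<in>T. 0 \<le> c a"
    by (auto simp: conical_hull_def)
  have "coord_sum x UNIV = 0"
    unfolding x coord_sum_cone by (intro sum.neutral) (auto simp: coord_sum_arc)
  moreover have "0 \<le> coord_sum x A" if "predecessor_closed T A" for A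
    unfolding x coord_sum_cone using c that
    by (intro sum_nonneg mult_nonneg_nonneg)
       (auto simp: coord_sum_arc indicator_def dest: predecessor_closedD)
  ultimately show ?R by (simp add: V0_def coord_sum_def)
next
  assume R: ?R
  show "x \<in> conical_hull T ?v"
  proof (rule ccontr)
    let ?K = "convex_cone hull (?v ` T)"
    assume "x \<notin> conical_hull T ?v"
    then have "x \<notin> ?K"
      using convex_cone_hull_image_subset_conical_hull[of T ?v] by auto
    then obtain y b where yb: "y \<bullet> x < b" "\<And>z. z \<in> ?K \<Longrightarrow> b < y \<bullet> z"
      using separating_hyperplane_closed_point[of ?K x]
      by (auto simp: convex_convex_cone_hull closed_convex_cone_hull)
    have "b < 0" using yb(2)[OF convex_cone_hull_contains_0] by simp
    \<comment> \<open>Otherwise some nonnegative multiple of the generator has inner product exactly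
      \<open>b\<close> with \<open>y\<close>, against strict separation.\<close>
    have mono: "y $ j \<le> y $ i" if "(i, j) \<in> T" for i j
    proof (rule ccontr)
      assume "\<not> y $ j \<le> y $ i"
      then have neg: "y \<bullet> ?v (i, j) < 0" by (simp add: inner_arc)
      define t where "t = b / (y \<bullet> ?v (i, j))"
      have "0 \<le> t" using neg \<open>b < 0\<close> by (simp add: t_def divide_nonpos_neg)
      then have "t *\<^sub>R ?v (i, j) \<in> ?K"
        using that by (intro convex_cone_hull_mul hull_inc) force+
      from yb(2)[OF this] neg show False by (simp add: t_def)
    qed
    \<comment> \<open>The left side is 0 because \<open>x\<close> lies in \<open>V0\<close>.\<close>
    have "Min (range (($) y)) * sum (($) x) UNIV \<le> (\<Sum>i\<in>UNIV. y $ i * x $ i)"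
    proof (rule sum_mult_ge_if_upper_sums_nonneg)
      fix B assume "\<And>i j. i \<in> B \<Longrightarrow> j \<in> UNIV \<Longrightarrow> y $ i \<le> y $ j \<Longrightarrow> j \<in> B"
      then have "predecessor_closed T B"
        using mono by (fastforce simp: predecessor_closed_def)
      then show "0 \<le> sum (($) x) B" using R by (simp add: coord_sum_def)
    qed auto
    then have "0 \<le> y \<bullet> x"
      using R by (simp add: V0_def inner_vec_def)
    with yb(1) \<open>b < 0\<close> show False by simp
  qed
qed

section \<open>Acyclicity of an oriented tree\<close>

text \<open>A directed cycle of \<open>T\<close> is a cycle of the symmetric closure, so it has
  length at most two. It is then a loop or an antiparallel pair, and asymmetry excludes
  both.\<close>

lemma directed_tree_imp_acyclic:
  fixes T :: "('n::finite \<times> 'n) set"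
  assumes "directed_tree T"
  shows "acyclic T"
proof (rule ccontr)
  define G where "G = with_proj \<lparr>pverts = UNIV, parcs = T\<rparr>"
  define H where "H = with_proj (mk_symmetric G)"
  have asym: "asym T" and no_cycle: "\<And>p. pre_digraph.cycle H p \<Longrightarrow> length p < 3"
    using assms by (auto simp: directed_tree_def Let_def G_def H_def not_le)
  interpret G: wf_digraph G by unfold_locales (auto simp: G_def)
  interpret H: wf_digraph H
    by unfold_locales (auto simp: H_def G_def mk_symmetric_def)
  assume "\<not> acyclic T"
  then obtain u where "(u, u) \<in> T\<^sup>+" by (auto simp: acyclic_def)
  then have "u \<rightarrow>\<^sup>+\<^bsub>G\<^esub> u" by (simp add: G_def arcs_ends_def arc_to_ends_def)
  then obtain q where "G.awalk u q u" "q \<noteq> []" by (auto simp: G.reachable1_awalk)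
  then obtain p where p: "G.cycle p"
    using G.closed_w_imp_cycle by (auto simp: G.closed_w_def)
  have "subgraph G H"
  proof (rule subgraphI)
    show "verts G \<subseteq> verts H" "arcs G \<subseteq> arcs H" "compatible H G"
      by (auto simp: G_def H_def mk_symmetric_def compatible_def)
  qed (rule G.wf_digraph_axioms H.wf_digraph_axioms)+
  then have "length p < 3" using no_cycle H.subgraph_cycle p by blast
  moreover from p obtain v where v: "G.awalk v p v" "p \<noteq> []" by (auto simp: G.cycle_def)
  ultimately consider a where "p = [a]" | a b where "p = [a, b]"
    by (cases p; cases "tl p"; cases "tl (tl p)") auto
  then show False
  proof cases
    case 1
    then have "a \<in> T" "fst a = v" "snd a = v"
      using v by (auto simp: G.awalk_simps) (auto simp: G_def)
    then show False using asym by (metis asymD prod.collapse)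
  next
    case 2
    then have "a \<in> T" "b \<in> T" "fst a = snd b" "snd a = fst b"
      using v by (auto simp: G.awalk_simps) (auto simp: G_def)
    then show False using asym by (metis asymD prod.collapse)
  qed
qed

section \<open>Plates as flags, and the final identity\<close>

text \<open>The two added indices cost nothing: the empty sum and the total sum are both 0. This
  brings plates into the form used in \<open>flags\<close>.\<close>

lemma mem_plate_iff_prefixes:
  fixes x :: "real ^ 'n::finite"
  assumes "\<pi> \<in> ordered_set_partitions" "x \<in> V0"
  shows "x \<in> plate \<pi> \<longleftrightarrow> (\<forall>m\<le>length \<pi>. 0 \<le> sum (($) x) (\<Union>(set (take m \<pi>))))"
proof -
  have un: "\<Union>(set \<pi>) = UNIV"
    using assms(1) by (simp add: ordered_set_partitions_def partition_on_def)
  have "0 \<le> sum (($) x) (\<Union>(set (take m \<pi>)))" if "m = 0 \<or> m = length \<pi>" for m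
    using that assms(2) un by (auto simp: V0_def)
  then show ?thesis
    using assms(2) unfolding plate_def coord_sum_def
    by (auto simp: Suc_le_eq)
qed

text \<open>Ensures that \<open>CARD('n) - length \<pi>\<close> is not truncated and so has the
  parity of the exponent in \<open>signed_flags\<close>.\<close>

lemma length_ordered_set_partition_le:
  fixes \<pi> :: "'n::finite set list"
  assumes "\<pi> \<in> ordered_set_partitions"
  shows "length \<pi> \<le> CARD('n)"
proof -
  have "distinct \<pi>" and part: "partition_on UNIV (set \<pi>)"
    using assms by (auto simp: ordered_set_partitions_def)
  then have "length \<pi> = card (set \<pi>)" by (simp add: distinct_card)
  also have "\<dots> = (\<Sum>S\<in>set \<pi>. 1)" by simp
  also have "\<dots> \<le> (\<Sum>S\<in>set \<pi>. card S)"
    using part by (intro sum_mono) (auto simp: partition_on_def Suc_le_eq card_gt_0_iff)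
  also have "\<dots> = CARD('n)"
    using part by (subst card_Union_disjoint[symmetric]) (auto simp: partition_on_def disjoint_def pairwise_def disjnt_def)
  finally show ?thesis .
qed

lemma sum_apply: "(\<Sum>a\<in>A. f a) x = (\<Sum>a\<in>A. f a x)"
  for f :: "'i \<Rightarrow> 'x \<Rightarrow> 'b::comm_monoid_add"
  by (induction A rule: infinite_finite_induct) auto

theorem theorem5p1:
  fixes T :: "('n::finite \<times> 'n) set"
  assumes "directed_tree T"
  defines "C \<equiv> conical_hull T (\<lambda>(i, j). axis i 1 - axis j 1 :: real ^ 'n)"
  shows "(indicator C :: real ^ 'n \<Rightarrow> complex) \<in> plate_space \<and>
    (indicator C :: real ^ 'n \<Rightarrow> complex) =
      (\<lambda>x. \<Sum>\<pi> | \<pi> \<in> ordered_set_partitions \<and> (\<forall>(i, j)\<in>T. strictly_left \<pi> i j).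
             (-1) ^ (CARD('n) - length \<pi>) * indicator (plate \<pi>) x)"
proof -
  define P where
    "P = {\<pi> :: 'n set list. \<pi> \<in> ordered_set_partitions \<and> (\<forall>(i, j)\<in>T. strictly_left \<pi> i j)}"
  have finP: "finite P"
    unfolding P_def by (rule finite_subset[OF _ finite_ordered_set_partitions]) auto
  have eq: "(indicator C :: real ^ 'n \<Rightarrow> complex) =
      (\<lambda>x. \<Sum>\<pi>\<in>P. (-1) ^ (CARD('n) - length \<pi>) * indicator (plate \<pi>) x)"
  proof
    fix x :: "real ^ 'n"
    let ?good = "\<lambda>B. 0 \<le> sum (($) x) B"
    show "(indicator C x :: complex) =
        (\<Sum>\<pi>\<in>P. (-1) ^ (CARD('n) - length \<pi>) * indicator (plate \<pi>) x)"
    proof (cases "x \<in> V0")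
      case False
      \<comment> \<open>The cone and all plates are contained in \<open>V0\<close>, so both sides
        are 0.\<close>
      then show ?thesis by (simp add: C_def mem_arc_cone_iff plate_def indicator_def)
    next
      case True
      have flags: "flags T ?good UNIV = {\<pi> \<in> P. x \<in> plate \<pi>}"
        using mem_plate_iff_prefixes[OF _ True]
        by (auto simp: flags_def P_def ordered_set_partitions_def)
      have "indicator C x = (signed_flags T ?good UNIV :: complex)"
        using True
        by (simp add: signed_flags_UNIV[OF directed_tree_imp_acyclic[OF assms(1)]]
            C_def mem_arc_cone_iff indicator_def coord_sum_def)
      also have "\<dots> = (\<Sum>\<pi>\<in>{\<pi> \<in> P. x \<in> plate \<pi>}. (-1) ^ (CARD('n) - length \<pi>))"
        unfolding signed_flags_def flags
      proof (rule sum.cong[OF refl])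
        fix \<pi> assume "\<pi> \<in> {\<pi> \<in> P. x \<in> plate \<pi>}"
        then have "length \<pi> \<le> CARD('n)"
          by (simp add: P_def length_ordered_set_partition_le)
        then show "(-1 :: complex) ^ (CARD('n) + length \<pi>) = (-1) ^ (CARD('n) - length \<pi>)"
          by (simp add: minus_one_power_iff)
      qed
      also have "\<dots> = (\<Sum>\<pi>\<in>P. (-1) ^ (CARD('n) - length \<pi>) * indicator (plate \<pi>) x)"
        unfolding sum.inter_filter[OF finP] by (rule sum.cong) (auto simp: indicator_def)
      finally show ?thesis .
    qed
  qed
  \<comment> \<open>The pointwise identity is rewritten as a linear combination of vectors in the
    function space, which shows membership in the span.\<close>
  have "indicator C = (\<Sum>\<pi>\<in>P. fun_scale ((-1) ^ (CARD('n) - length \<pi>)) (indicator (plate \<pi>)))"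
    unfolding eq by (rule ext) (simp add: fun_scale_def sum_apply)
  moreover have "\<dots> \<in> plate_space"
    unfolding plate_space_def
    by (intro fun_space.span_sum fun_space.span_scale fun_space.span_base) (auto simp: P_def)
  ultimately show ?thesis using eq by (simp add: P_def)
qed

end
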